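(* Let $\gamma_1,\gamma_2\in[0,1/2]$ with $\gamma_1\neq\gamma_2$. Then there exists a sequence $(x_n)_{n\in\mathbb{N}}\subseteq[0,1]$ that has $\gamma_1$-PPC but does not have $\gamma_2$-PPC.
   Context: For $x\in\mathbb{R}$, $\|x\|=\min\{|x-k|:k\in\mathbb{Z}\}$. For a sequence $(x_n)_{n\in\mathbb{N}}\subseteq[0,1]$, $\gamma\in\mathbb{R}$, $s>0$ and $N\in\mathbb{N}$, define $$R_2(\gamma;s,N)=\frac{1}{N}\#\Big\{1\leqslant m\neq n\leqslant N:\ \|x_m-x_n-\gamma\|\leqslant \frac{s}{N}\Big\}.$$ The sequence has $\gamma$-PPC if $\lim_{N\to\infty}R_2(\gamma;s,N)=2s$ for all $s>0$. (For $\gamma=0$ this is the classical Poissonian pair correlation property.) *)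

theory Defs
  imports "HOL-Analysis.Analysis"
begin

text \<open>\<^const>\<open>Min\<close> is only meaningful on finite sets, so the minimum over all integers is
  written as an infimum; lemma \<open>int_dist_attained\<close> shows that it is attained.\<close>

definition int_dist :: "real \<Rightarrow> real" where
  "int_dist x = (INF k::int. \<bar>x - of_int k\<bar>)"

lemma int_dist_le: "int_dist x \<le> \<bar>x - of_int k\<bar>"
  unfolding int_dist_def by (rule cINF_lower) (auto intro!: bdd_belowI[of _ 0])

lemma int_dist_attained: "\<exists>k::int. int_dist x = \<bar>x - of_int k\<bar>"
proof -
  have "\<bar>x - of_int (round x)\<bar> \<le> \<bar>x - of_int k\<bar>" for k :: int
    using round_diff_minimal[of x k] .
  then have "\<bar>x - of_int (round x)\<bar> \<le> int_dist x"
    unfolding int_dist_def by (intro cINF_greatest) auto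
  then show ?thesis
    using int_dist_le[of x "round x"] by (intro exI[of _ "round x"]) simp
qed

text \<open>Sequences are indexed from 1; the value \<open>x 0\<close> plays no role.\<close>

definition R2 :: "(nat \<Rightarrow> real) \<Rightarrow> real \<Rightarrow> real \<Rightarrow> nat \<Rightarrow> real" where
  "R2 x \<gamma> s N =
     1 / real N * real (card {(m, n). m \<in> {1..N} \<and> n \<in> {1..N} \<and> m \<noteq> n \<and>
                                int_dist (x m - x n - \<gamma>) \<le> s / real N})"

definition PPC :: "real \<Rightarrow> (nat \<Rightarrow> real) \<Rightarrow> bool" where
  "PPC \<gamma> x \<longleftrightarrow> (\<forall>s>0. (\<lambda>N. R2 x \<gamma> s N) \<longlonglongrightarrow> 2 * s)"

end

(* Let y be a sequence of independent uniform points. For i \<noteq> j the event that y i - y j lies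
   within r < 1/2 of \<beta> modulo 1 has probability 2 r, and two such events are independent unless they
   involve the same unordered pair of indices. Hence R2 y \<beta> s N has variance O(1/N), so along the
   squares it converges almost surely to 2 s for each rational s; monotonicity in s and N extends
   this to all s and N. Thus some y has \<beta>-PPC for all \<beta> in a given countable set.

   Now let x be the sequence y 1, y 1 + \<gamma>2, y 2, y 2 + \<gamma>2, ... modulo 1. The pairs (y j + \<gamma>2, y j)
   alone contribute 1/2 to R2 x \<gamma>2 s N, for arbitrarily small s. For \<gamma>1 these pairs are eventually
   irrelevant, and the others are counted by R2 y \<beta> with \<beta> = \<gamma>1, \<gamma>1 - \<gamma>2, \<gamma>1 + \<gamma>2. *)

theory Submission
  imports Defs "HOL-Probability.Infinite_Product_Measure"
begin

section \<open>Distance to the nearest integer\<close>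

lemma int_dist_round: "int_dist x = \<bar>x - of_int (round x)\<bar>"
proof (rule antisym[OF int_dist_le])
  obtain k :: int where "int_dist x = \<bar>x - of_int k\<bar>"
    using int_dist_attained by blast
  then show "\<bar>x - of_int (round x)\<bar> \<le> int_dist x"
    using round_diff_minimal[of x k] by simp
qed

lemma measurable_int_dist [measurable]: "int_dist \<in> borel_measurable borel"
proof -
  have *: "int_dist = (\<lambda>x. \<bar>x - real_of_int \<lfloor>x + 1/2\<rfloor>\<bar>)"
    by (simp add: int_dist_round round_def fun_eq_iff)
  show ?thesis unfolding * by measurable
qed

lemma int_dist_le_iff: "int_dist x \<le> r \<longleftrightarrow> (\<exists>k::int. \<bar>x - of_int k\<bar> \<le> r)"
  using int_dist_attained[of x] int_dist_le[of x] by (metis order_trans)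

lemma int_dist_minus: "int_dist (- x) = int_dist x"
proof -
  have le: "int_dist (- y) \<le> int_dist y" for y
  proof -
    obtain k :: int where "int_dist y = \<bar>y - of_int k\<bar>"
      using int_dist_attained by blast
    then show ?thesis
      using int_dist_le[of "- y" "- k"] by simp
  qed
  from le[of x] le[of "- x"] show ?thesis by simp
qed

lemma int_dist_add_int: "int_dist (x + of_int k) = int_dist x"
proof -
  have "\<lfloor>x + of_int k + 1/2\<rfloor> = \<lfloor>x + 1/2\<rfloor> + k" by linarith
  then show ?thesis by (simp add: int_dist_round round_def)
qed

lemma int_dist_pos: "x \<notin> \<int> \<Longrightarrow> 0 < int_dist x"
  using int_dist_attained[of x] by auto

text \<open>Shifting by an integer moves the centre to \<open>d = frac c\<close> in [0,1). The set
  is then an interval of length \<open>2 * r\<close>, or, when it wraps around an end of [0,1), two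
  intervals of that total length, disjoint because \<open>r < 1/2\<close>.\<close>

lemma emeasure_int_dist_le:
  assumes "0 \<le> r" "r < 1/2"
  shows "emeasure lborel {t \<in> {0..<1}. int_dist (t - c) \<le> r} = ennreal (2 * r)"
proof -
  define d where "d = frac c"
  have d: "0 \<le> d" "d < 1"
    by (auto simp: d_def frac_lt_1)
  have "int_dist (t - c) = int_dist (t - d)" for t
    using int_dist_add_int[of "t - d" "- \<lfloor>c\<rfloor>"] by (simp add: d_def frac_def algebra_simps)
  moreover have "int_dist (t - d) \<le> r \<longleftrightarrow> \<bar>t - d\<bar> \<le> r \<or> \<bar>t - d - 1\<bar> \<le> r \<or> \<bar>t - d + 1\<bar> \<le> r"
    if "t \<in> {0..<1}" for t
  proof
    assume "int_dist (t - d) \<le> r"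
    then obtain k :: int where k: "\<bar>t - d - of_int k\<bar> \<le> r"
      by (auto simp: int_dist_le_iff)
    \<comment> \<open>\<open>t\<close> and \<open>d\<close> both lie in [0,1), so |t - d| < 1 and
      |k| < 1 + 1/2.\<close>
    with that d assms have "real_of_int k < 2" "real_of_int k > -2"
      by (auto simp: abs_le_iff)
    then have "k \<in> {-1, 0, 1}" by auto
    with k show "\<bar>t - d\<bar> \<le> r \<or> \<bar>t - d - 1\<bar> \<le> r \<or> \<bar>t - d + 1\<bar> \<le> r"
      by auto
  next
    assume "\<bar>t - d\<bar> \<le> r \<or> \<bar>t - d - 1\<bar> \<le> r \<or> \<bar>t - d + 1\<bar> \<le> r"
    then show "int_dist (t - d) \<le> r"
      using int_dist_le[of "t - d" 0] int_dist_le[of "t - d" 1] int_dist_le[of "t - d" "-1"]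
      by auto
  qed
  ultimately have S: "{t \<in> {0..<1}. int_dist (t - c) \<le> r} =
      {t \<in> {0..<1}. \<bar>t - d\<bar> \<le> r \<or> \<bar>t - d - 1\<bar> \<le> r \<or> \<bar>t - d + 1\<bar> \<le> r}" (is "_ = ?S")
    by auto
  consider "d < r" | "r \<le> d" "d + r < 1" | "1 \<le> d + r" by linarith
  then have "emeasure lborel ?S = ennreal (2 * r)"
  proof cases
    case 1
    have "?S = {0..d + r} \<union> {d + 1 - r..<1}"
      using 1 d assms by (auto simp: abs_le_iff)
    moreover have "emeasure lborel ({0..d + r} \<union> {d + 1 - r..<1}) = 
        emeasure lborel {0..d + r} + emeasure lborel {d + 1 - r..<1}"
      using assms by (intro plus_emeasure[symmetric]) auto
    ultimately show ?thesis
      using 1 d assms by (simp flip: ennreal_plus)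
  next
    case 2
    have "?S = {d - r..d + r}"
      using 2 d assms by (auto simp: abs_le_iff)
    then show ?thesis using assms by simp
  next
    case 3
    have "?S = {d - r..<1} \<union> {0..d + r - 1}"
      using 3 d assms by (auto simp: abs_le_iff)
    moreover have "emeasure lborel ({d - r..<1} \<union> {0..d + r - 1}) = 
        emeasure lborel {d - r..<1} + emeasure lborel {0..d + r - 1}"
      using assms by (intro plus_emeasure[symmetric]) auto
    ultimately show ?thesis
      using 3 d assms by (simp flip: ennreal_plus)
  qed
  with S show ?thesis by simp
qed

section \<open>Independent uniform points in [0,1)\<close>

definition unif_seq :: "(nat \<Rightarrow> real) measure" where
  "unif_seq = PiM UNIV (\<lambda>_. uniform_measure lborel {0..<1})"

lemma prob_space_unif: "prob_space (uniform_measure lborel {0..<1::real})"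
  by (rule prob_space_uniform_measure) auto

interpretation unif_seq: prob_space unif_seq
  unfolding unif_seq_def by (intro prob_space_PiM prob_space_unif)

lemma space_unif_seq [simp]: "space unif_seq = UNIV"
  by (simp add: unif_seq_def space_PiM)

lemma sets_unif_seq: "sets unif_seq = sets (PiM UNIV (\<lambda>_. borel))"
  unfolding unif_seq_def by (intro sets_PiM_cong) auto

lemma measurable_unif_seq_component [measurable]: "(\<lambda>\<omega>. \<omega> n) \<in> borel_measurable unif_seq"
  by (subst measurable_cong_sets[OF sets_unif_seq refl]) simp

text \<open>The product measure is invariant under replacing coordinate \<open>m\<close> by an independent copy
  (\<open>distr_pair_PiM_eq_PiM\<close> with \<open>insert m UNIV = UNIV\<close>), so coordinate \<open>m\<close> can be integrated out
  first.\<close>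

lemma emeasure_resample:
  assumes B [measurable]: "B \<in> sets unif_seq" and c [measurable]: "c \<in> borel_measurable unif_seq"
    and Bm: "\<And>\<omega> t. fun_upd \<omega> m t \<in> B \<longleftrightarrow> \<omega> \<in> B" and cm: "\<And>\<omega> t. c (fun_upd \<omega> m t) = c \<omega>"
    and r: "0 \<le> r" "r < 1/2"
  shows "emeasure unif_seq {\<omega> \<in> B. int_dist (\<omega> m - c \<omega>) \<le> r} = ennreal (2 * r) * emeasure unif_seq B"
proof -
  let ?U = "uniform_measure lborel {0..<1::real}" and ?g = "\<lambda>(t, \<omega>). fun_upd \<omega> m t"
  let ?X = "{\<omega> \<in> B. int_dist (\<omega> m - c \<omega>) \<le> r}"
  interpret U: prob_space ?U by (rule prob_space_unif)
  interpret pair_sigma_finite ?U unif_seq by unfold_locales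
  have X: "?X \<in> sets unif_seq"
  proof -
    have "{\<omega> \<in> space unif_seq. \<omega> \<in> B \<and> int_dist (\<omega> m - c \<omega>) \<le> r} \<in> sets unif_seq"
      by measurable
    then show ?thesis by simp
  qed
  have D: "unif_seq = distr (?U \<Otimes>\<^sub>M unif_seq) unif_seq ?g"
    using distr_pair_PiM_eq_PiM[of UNIV "\<lambda>_. ?U" m] prob_space_unif by (simp add: unif_seq_def)
  have g: "?g \<in> measurable (?U \<Otimes>\<^sub>M unif_seq) unif_seq"
  proof -
    have "(\<lambda>p. fun_upd (snd p) m (fst p)) \<in> measurable (?U \<Otimes>\<^sub>M unif_seq) unif_seq"
      unfolding unif_seq_def
      by (rule measurable_fun_upd[where J="UNIV"]) auto
    then show ?thesis by (simp add: case_prod_unfold)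
  qed
  have "emeasure unif_seq ?X = emeasure (?U \<Otimes>\<^sub>M unif_seq) (?g -` ?X \<inter> space (?U \<Otimes>\<^sub>M unif_seq))"
    by (subst D, rule emeasure_distr[OF g X])
  also have "\<dots> = (\<integral>\<^sup>+\<omega>. emeasure ?U ((\<lambda>t. (t, \<omega>)) -` (?g -` ?X \<inter> space (?U \<Otimes>\<^sub>M unif_seq))) \<partial>unif_seq)"
    by (rule emeasure_pair_measure_alt2[OF measurable_sets[OF g X]])
  also have "\<dots> = (\<integral>\<^sup>+\<omega>. ennreal (2 * r) * indicator B \<omega> \<partial>unif_seq)"
  proof (rule nn_integral_cong)
    fix \<omega>
    \<comment> \<open>Neither \<open>B\<close> nor \<open>c\<close> sees coordinate
      \<open>m\<close>: with the other coordinates fixed, membership in \<open>B\<close> is decided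
      and the centre \<open>c \<omega>\<close> is a constant.\<close>
    have *: "(\<lambda>t. (t, \<omega>)) -` (?g -` ?X \<inter> space (?U \<Otimes>\<^sub>M unif_seq)) =
        (if \<omega> \<in> B then {t. int_dist (t - c \<omega>) \<le> r} else {})"
      by (auto simp: Bm cm space_pair_measure)
    have "emeasure ?U {t. int_dist (t - c \<omega>) \<le> r} = emeasure lborel ({0..<1} \<inter> {t. int_dist (t - c \<omega>) \<le> r})"
      by (subst emeasure_uniform_measure) (auto simp: divide_ennreal_def)
    also have "\<dots> = ennreal (2 * r)"
      using emeasure_int_dist_le[OF r, of "c \<omega>"] by (simp add: Int_def)
    finally show "emeasure ?U ((\<lambda>t. (t, \<omega>)) -` (?g -` ?X \<inter> space (?U \<Otimes>\<^sub>M unif_seq))) =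
        ennreal (2 * r) * indicator B \<omega>"
      unfolding * by simp
  qed
  also have "\<dots> = ennreal (2 * r) * emeasure unif_seq B"
    by (simp add: nn_integral_cmult_indicator)
  finally show ?thesis .
qed

section \<open>Independence and variance of close pairs\<close>

definition close_pair :: "real \<Rightarrow> real \<Rightarrow> nat \<times> nat \<Rightarrow> (nat \<Rightarrow> real) set" where
  "close_pair \<beta> r p = {\<omega>. int_dist (\<omega> (fst p) - \<omega> (snd p) - \<beta>) \<le> r}"

lemma sets_close_pair [measurable]: "close_pair \<beta> r p \<in> sets unif_seq"
proof -
  have "{\<omega> \<in> space unif_seq. int_dist (\<omega> (fst p) - \<omega> (snd p) - \<beta>) \<le> r} \<in> sets unif_seq"
    by measurable
  then show ?thesis by (simp add: close_pair_def)
qed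

text \<open>One endpoint \<open>i\<close> of the pair is resampled while \<open>B\<close> stays
  fixed: closeness says that coordinate \<open>i\<close> is within \<open>r\<close> of a centre
  determined by the other endpoint. If \<open>i\<close> is the second endpoint, this uses the
  symmetry of \<open>int_dist\<close>.\<close>

lemma prob_close_pair_Int:
  assumes r: "0 \<le> r" "r < 1/2" and B [measurable]: "B \<in> sets unif_seq"
    and i: "i = fst p \<or> i = snd p" "fst p \<noteq> snd p" and Bi: "\<And>\<omega> t. fun_upd \<omega> i t \<in> B \<longleftrightarrow> \<omega> \<in> B"
  shows "unif_seq.prob (close_pair \<beta> r p \<inter> B) = 2 * r * unif_seq.prob B"
proof -
  obtain c where [measurable]: "c \<in> borel_measurable unif_seq"
    and c: "\<And>\<omega> t. c (fun_upd \<omega> i t) = c \<omega>"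
    and eq: "\<And>\<omega>. int_dist (\<omega> (fst p) - \<omega> (snd p) - \<beta>) = int_dist (\<omega> i - c \<omega>)"
  proof (cases "i = fst p")
    case True
    show thesis
      by (rule that[of "\<lambda>\<omega>. \<omega> (snd p) + \<beta>"]) (use True i in \<open>auto simp: algebra_simps\<close>)
  next
    case False
    with i have i': "i = snd p" by simp
    have "int_dist (\<omega> (fst p) - \<omega> (snd p) - \<beta>) = int_dist (\<omega> i - (\<omega> (fst p) - \<beta>))" for \<omega>
      using int_dist_minus[of "\<omega> i - (\<omega> (fst p) - \<beta>)"] i' by (simp add: algebra_simps)
    then show thesis
      by (intro that[of "\<lambda>\<omega>. \<omega> (fst p) - \<beta>"]) (use i i' in auto)
  qed
  have "close_pair \<beta> r p \<inter> B = {\<omega> \<in> B. int_dist (\<omega> i - c \<omega>) \<le> r}"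
    by (auto simp: close_pair_def eq)
  then have "emeasure unif_seq (close_pair \<beta> r p \<inter> B) = ennreal (2 * r) * emeasure unif_seq B"
    using emeasure_resample[OF B _ Bi c r] by simp
  then show ?thesis
    using r by (simp add: measure_def enn2real_mult)
qed

lemma prob_close_pair:
  assumes "0 \<le> r" "r < 1/2" "fst p \<noteq> snd p"
  shows "unif_seq.prob (close_pair \<beta> r p) = 2 * r"
  using prob_close_pair_Int[of r UNIV "fst p" p \<beta>] assms unif_seq.prob_space sets.top[of unif_seq] by simp

text \<open>Two distinct unordered pairs may share an index, but \<open>p\<close> still has an
  endpoint outside \<open>q\<close>. Resampling that endpoint leaves the event for \<open>q\<close>
  unchanged, which gives independence.\<close>

lemma prob_close_pairs_Int:
  assumes r: "0 \<le> r" "r < 1/2" and "fst p \<noteq> snd p" "fst q \<noteq> snd q" "q \<noteq> p" "q \<noteq> prod.swap p"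
  shows "unif_seq.prob (close_pair \<beta> r p \<inter> close_pair \<beta> r q) = (2 * r)\<^sup>2"
proof -
  have "fst p \<notin> {fst q, snd q} \<or> snd p \<notin> {fst q, snd q}"
    using assms by (cases p; cases q) auto
  then obtain i where i: "i = fst p \<or> i = snd p" "i \<noteq> fst q" "i \<noteq> snd q" by auto
  have "unif_seq.prob (close_pair \<beta> r p \<inter> close_pair \<beta> r q) = 2 * r * unif_seq.prob (close_pair \<beta> r q)"
  proof (rule prob_close_pair_Int[OF r _ i(1)])
    show "fun_upd \<omega> i t \<in> close_pair \<beta> r q \<longleftrightarrow> \<omega> \<in> close_pair \<beta> r q" for \<omega> t
      using i by (simp add: close_pair_def)
  qed (use assms in auto)
  then show ?thesis
    using prob_close_pair[OF r] assms by (simp add: power2_eq_square)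
qed

text \<open>Expanding the square leaves covariances. They vanish unless \<open>q\<close> is
  \<open>p\<close> or its swap, and each of these at most two terms per \<open>p\<close> is at most
  \<open>2 * r\<close>.\<close>

lemma variance_close_pairs:
  assumes r: "0 \<le> r" "r < 1/2" and fin: "finite P" and P: "\<And>p. p \<in> P \<Longrightarrow> fst p \<noteq> snd p"
  shows "(\<integral>\<omega>. (\<Sum>p\<in>P. indicator (close_pair \<beta> r p) \<omega> - 2 * r)\<^sup>2 \<partial>unif_seq) \<le> 4 * r * card P"
proof -
  let ?I = "\<lambda>p \<omega>. indicator (close_pair \<beta> r p) \<omega> :: real"
  have ex: "(\<integral>\<omega>. (?I p \<omega> - 2 * r) * (?I q \<omega> - 2 * r) \<partial>unif_seq) =
      unif_seq.prob (close_pair \<beta> r p \<inter> close_pair \<beta> r q) - (2 * r)\<^sup>2" if "p \<in> P" "q \<in> P" for p q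
  proof -
    have "(\<lambda>\<omega>. (?I p \<omega> - 2 * r) * (?I q \<omega> - 2 * r)) =
       (\<lambda>\<omega>. indicator (close_pair \<beta> r p \<inter> close_pair \<beta> r q) \<omega> - 2 * r * ?I p \<omega> - 2 * r * ?I q \<omega> + (2*r)\<^sup>2)"
      by (auto simp: indicator_def power2_eq_square algebra_simps)
    moreover have "integrable unif_seq (indicator A :: _ \<Rightarrow> real)" if "A \<in> sets unif_seq" for A
      using that by (simp add: integrable_indicator_iff less_top[symmetric])
    ultimately show ?thesis
      using prob_close_pair[OF r P] that
      by (simp add: Bochner_Integration.integral_diff Bochner_Integration.integral_add
          unif_seq.prob_space[simplified] power2_eq_square)
  qed
  have "(\<integral>\<omega>. (\<Sum>p\<in>P. ?I p \<omega> - 2 * r)\<^sup>2 \<partial>unif_seq) =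
      (\<integral>\<omega>. (\<Sum>p\<in>P. \<Sum>q\<in>P. (?I p \<omega> - 2 * r) * (?I q \<omega> - 2 * r)) \<partial>unif_seq)"
    by (simp add: power2_eq_square sum_product)
  also have "\<dots> = (\<Sum>p\<in>P. \<Sum>q\<in>P. \<integral>\<omega>. (?I p \<omega> - 2 * r) * (?I q \<omega> - 2 * r) \<partial>unif_seq)"
  proof -
    have "\<bar>?I p \<omega> - 2 * r\<bar> \<le> 1" for p \<omega>
      using r by (simp add: indicator_def)
    then have "\<bar>(?I p \<omega> - 2 * r) * (?I q \<omega> - 2 * r)\<bar> \<le> 1" for p q \<omega>
      unfolding abs_mult by (intro mult_le_one) auto
    then have "integrable unif_seq (\<lambda>\<omega>. (?I p \<omega> - 2 * r) * (?I q \<omega> - 2 * r))" for p q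
      by (intro unif_seq.integrable_const_bound[where B=1]) auto
    then show ?thesis by (simp add: Bochner_Integration.integral_sum)
  qed
  also have "\<dots> \<le> (\<Sum>p\<in>P. \<Sum>q\<in>P. if q = p \<or> q = prod.swap p then 2 * r else 0)"
  proof (intro sum_mono)
    \<comment> \<open>For nonzero \<open>\<beta>\<close> the events of \<open>p\<close> and its swap
      can differ, so their intersection is only bounded by the probability of one of them.\<close>
    fix p q assume pq: "p \<in> P" "q \<in> P"
    have "unif_seq.prob (close_pair \<beta> r p \<inter> close_pair \<beta> r q) \<le> unif_seq.prob (close_pair \<beta> r p)"
      by (rule unif_seq.finite_measure_mono) auto
    then have "unif_seq.prob (close_pair \<beta> r p \<inter> close_pair \<beta> r q) \<le> 2 * r"
      using prob_close_pair[OF r P] pq by simp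
    moreover have "0 \<le> (2 * r)\<^sup>2" by simp
    ultimately have "unif_seq.prob (close_pair \<beta> r p \<inter> close_pair \<beta> r q) - (2 * r)\<^sup>2 \<le> 2 * r"
      by linarith
    then show "(\<integral>\<omega>. (?I p \<omega> - 2 * r) * (?I q \<omega> - 2 * r) \<partial>unif_seq)
        \<le> (if q = p \<or> q = prod.swap p then 2 * r else 0)"
      unfolding ex[OF pq] using prob_close_pairs_Int[OF r P P, of p q \<beta>] pq by simp
  qed
  also have "\<dots> \<le> (\<Sum>p\<in>P. 4 * r)"
  proof (rule sum_mono)
    fix p
    have "(\<Sum>q\<in>P. if q = p \<or> q = prod.swap p then 2 * r else 0) = (\<Sum>q\<in>P \<inter> {p, prod.swap p}. 2 * r)"
      unfolding sum.inter_restrict[OF fin] by (intro sum.cong) auto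
    also have "\<dots> \<le> (\<Sum>q\<in>{p, prod.swap p}. 2 * r)"
      using r by (intro sum_mono2) auto
    also have "\<dots> \<le> 4 * r"
      using r card_insert_le_m1[of 2 "{prod.swap p}" p] 
      by (cases "p = prod.swap p") auto
    finally show "(\<Sum>q\<in>P. if q = p \<or> q = prod.swap p then 2 * r else 0) \<le> 4 * r" .
  qed
  finally show ?thesis by (simp add: mult.commute)
qed

text \<open>By monotone convergence the sum of all \<open>f k\<close> has finite integral, so it is
  finite almost everywhere and its terms tend to 0. With second moments for \<open>f k\<close>, this
  stands in for Chebyshev and Borel-Cantelli.\<close>

lemma AE_tendsto_0:
  fixes f :: "nat \<Rightarrow> 'a \<Rightarrow> real"
  assumes int: "\<And>k. integrable M (f k)" and nn: "\<And>k \<omega>. 0 \<le> f k \<omega>"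
    and le: "\<And>k. (\<integral>\<omega>. f k \<omega> \<partial>M) \<le> b k" and b: "summable b"
  shows "AE \<omega> in M. (\<lambda>k. f k \<omega>) \<longlonglongrightarrow> 0"
proof -
  have b0: "0 \<le> b k" for k
    by (rule order_trans[OF Bochner_Integration.integral_nonneg le]) (rule nn)
  have [measurable]: "f k \<in> borel_measurable M" for k
    using int by auto
  have "(\<integral>\<^sup>+\<omega>. (\<Sum>k. ennreal (f k \<omega>)) \<partial>M) = (\<Sum>k. \<integral>\<^sup>+\<omega>. ennreal (f k \<omega>) \<partial>M)"
    by (rule nn_integral_suminf) measurable
  also have "\<dots> \<le> (\<Sum>k. ennreal (b k))"
    using nn le int by (intro suminf_le) (auto simp: nn_integral_eq_integral intro!: ennreal_leI)
  also have "\<dots> < \<infinity>"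
    using b b0 by (simp add: suminf_ennreal2)
  finally have "AE \<omega> in M. (\<Sum>k. ennreal (f k \<omega>)) \<noteq> \<infinity>"
    by (intro nn_integral_PInf_AE) auto
  then show ?thesis
  proof eventually_elim
    case (elim \<omega>)
    then have "summable (\<lambda>k. f k \<omega>)"
      using nn by (intro summable_suminf_not_top) auto
    then show ?case by (rule summable_LIMSEQ_zero)
  qed
qed

section \<open>Monotonicity of pair counts and passage from a subsequence to all N\<close>

definition close_pairs :: "(nat \<Rightarrow> real) \<Rightarrow> real \<Rightarrow> real \<Rightarrow> nat \<Rightarrow> (nat \<times> nat) set" where
  "close_pairs x \<gamma> r N = {(m, n). m \<in> {1..N} \<and> n \<in> {1..N} \<and> m \<noteq> n \<and> int_dist (x m - x n - \<gamma>) \<le> r}"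

lemma R2_eq: "R2 x \<gamma> s N = card (close_pairs x \<gamma> (s / N) N) / N"
  by (simp add: R2_def close_pairs_def)

lemma finite_close_pairs [simp]: "finite (close_pairs x \<gamma> r N)"
  by (rule finite_subset[of _ "{1..N} \<times> {1..N}"]) (auto simp: close_pairs_def)

lemma card_close_pairs_mono:
  "r \<le> r' \<Longrightarrow> N \<le> N' \<Longrightarrow> card (close_pairs x \<gamma> r N) \<le> card (close_pairs x \<gamma> r' N')"
  by (rule card_mono[OF finite_close_pairs]) (auto simp: close_pairs_def)

text \<open>\<open>N * R2 x \<gamma> s N\<close> is a plain count of pairs, and it grows with the
  range \<open>N\<close> and with the radius \<open>s / N\<close> separately.\<close>

lemma R2_le:
  assumes "0 < N" "N \<le> N'" "s / N \<le> s' / N'" 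
  shows "N * R2 x \<gamma> s N \<le> N' * R2 x \<gamma> s' N'"
proof -
  have "real N * R2 x \<gamma> s N = card (close_pairs x \<gamma> (s / N) N)"
    "real N' * R2 x \<gamma> s' N' = card (close_pairs x \<gamma> (s' / N') N')"
    using assms(1,2) by (simp_all add: R2_eq)
  then show ?thesis
    using card_close_pairs_mono[OF assms(3,2), of x \<gamma>] by simp
qed

lemma R2_nonneg: "0 \<le> R2 x \<gamma> s N"
  by (simp add: R2_eq)

text \<open>The index is the greatest \<open>k\<close> with \<open>a k \<le> N\<close>; it exists
  because \<open>k \<le> a k\<close>, and it exceeds any given bound once \<open>N\<close> is
  large.\<close>

lemma eventually_between_subseq:
  fixes a :: "nat \<Rightarrow> nat"
  assumes a: "strict_mono a" and P: "eventually P sequentially"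
  shows "\<forall>\<^sub>F N in sequentially. \<exists>k. P k \<and> a k \<le> N \<and> N < a (Suc k)"
proof -
  from P obtain K where K: "\<And>k. k \<ge> K \<Longrightarrow> P k"
    by (auto simp: eventually_sequentially)
  have "\<exists>k. P k \<and> a k \<le> N \<and> N < a (Suc k)" if N: "a K \<le> N" for N
  proof -
    let ?k = "GREATEST k. a k \<le> N"
    have bd: "k \<le> N" if "a k \<le> N" for k
      using strict_mono_imp_increasing[OF a, of k] that by linarith
    have "a ?k \<le> N"
      by (rule GreatestI_nat[of _ K N]) (use N bd in auto)
    moreover have "K \<le> ?k"
      by (rule Greatest_le_nat[of _ K N]) (use N bd in auto)
    moreover have "N < a (Suc ?k)"
    proof (rule ccontr)
      assume "\<not> N < a (Suc ?k)"
      then have "Suc ?k \<le> ?k"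
        by (intro Greatest_le_nat[of _ _ N]) (use bd in auto)
      then show False by simp
    qed
    ultimately show ?thesis using K by blast
  qed
  then show ?thesis by (auto simp: eventually_sequentially)
qed

text \<open>For \<open>a k \<le> N < a (Suc k)\<close> the count at \<open>N\<close> is compared
  with those at the two neighbours, taken at a rational \<open>q\<close> slightly above or below
  \<open>s\<close>. The gap between \<open>q\<close> and \<open>s\<close> absorbs the ratio of the
  neighbours. Rational \<open>q\<close> suffice, so almost sure statements need only countably many
  parameters.\<close>

lemma PPC_subseqI:
  fixes a :: "nat \<Rightarrow> nat"
  assumes a: "strict_mono a" and ratio: "(\<lambda>k. real (a (Suc k)) / real (a k)) \<longlonglongrightarrow> 1"
    and lim: "\<And>q. q \<in> \<rat> \<Longrightarrow> 0 < q \<Longrightarrow> (\<lambda>k. R2 x \<gamma> q (a k)) \<longlonglongrightarrow> 2 * q"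
  shows "PPC \<gamma> x"
  unfolding PPC_def
proof (intro allI impI order_tendstoI)
  fix s u :: real assume s: "0 < s"
  have pos: "\<forall>\<^sub>F k in sequentially. 0 < a k"
    using eventually_ge_at_top[of 1]
  proof eventually_elim
    case (elim k)
    then show ?case
      using strict_mono_imp_increasing[OF a, of k] by linarith
  qed
  {
    assume "2 * s < u"
    \<comment> \<open>The comparison with \<open>a (Suc k)\<close> costs a factor
      \<open>q / s\<close>, so the limit bound is \<open>2 * q * (q / s)\<close>. It is below
      \<open>u\<close> exactly when \<open>q\<^sup>2 < s * u / 2\<close>.\<close>
    then have "s\<^sup>2 < s * u / 2"
      using s by (simp add: power2_eq_square)
    then have "s < sqrt (s * u / 2)"
      using s by (intro real_less_rsqrt) auto
    then obtain q where q: "q \<in> \<rat>" "s < q" "q < sqrt (s * u / 2)"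
      using Rats_dense_in_real by blast
    then have q0: "0 < q" using s by simp
    have "q\<^sup>2 < s * u / 2"
      using q q0 real_sqrt_less_iff[of "q\<^sup>2" "s * u / 2"] by simp
    then have "2 * q < u / (q / s)"
      using s q0 by (simp add: field_simps power2_eq_square)
    then have ev1: "\<forall>\<^sub>F k in sequentially. R2 x \<gamma> q (a (Suc k)) < u / (q / s)"
      by (rule order_tendstoD(2)[OF LIMSEQ_Suc[OF lim[OF q(1) q0]]])
    have ev2: "\<forall>\<^sub>F k in sequentially. real (a (Suc k)) / real (a k) < q / s"
      using ratio q s by (auto intro: order_tendstoD)
    have "\<forall>\<^sub>F k in sequentially. R2 x \<gamma> q (a (Suc k)) < u / (q / s) \<and>
        real (a (Suc k)) / real (a k) < q / s \<and> 0 < a k"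
      using ev1 ev2 pos by eventually_elim auto
    from eventually_between_subseq[OF a this]
    show "\<forall>\<^sub>F N in sequentially. R2 x \<gamma> s N < u"
    proof eventually_elim
      case (elim N)
      then obtain k where k: "R2 x \<gamma> q (a (Suc k)) < u / (q / s)"
        "real (a (Suc k)) / real (a k) < q / s" "0 < a k" "a k \<le> N" "N < a (Suc k)"
        by blast
      \<comment> \<open>This serves twice: it compares the radii, and it bounds
        \<open>a (Suc k)\<close> by \<open>q / s * N\<close>.\<close>
      have c: "s * a (Suc k) < q * a k"
        using k s by (simp add: field_simps)
      also have "\<dots> \<le> q * N"
        using k q0 by simp
      finally have "s / N \<le> q / a (Suc k)"
        using k by (simp add: field_simps)
      then have "N * R2 x \<gamma> s N \<le> a (Suc k) * R2 x \<gamma> q (a (Suc k))"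
        using k by (intro R2_le) auto
      also have "\<dots> \<le> (q / s * N) * R2 x \<gamma> q (a (Suc k))"
        using c \<open>q * a k \<le> q * N\<close> s by (intro mult_right_mono R2_nonneg) (simp add: field_simps)
      also have "\<dots> < (q / s * N) * (u / (q / s))"
        using k q0 s by (intro mult_strict_left_mono) auto
      also have "\<dots> = N * u"
        using q0 s by simp
      finally show ?case
        using k by simp
    qed
  }
  {
    assume u: "u < 2 * s"
    \<comment> \<open>Mirror image: \<open>q\<close> below \<open>s\<close> with
      \<open>2 * q * (q / s) > u\<close>. The maximum with 0 keeps \<open>q\<close> positive even if
      \<open>u\<close> is negative.\<close>
    have "s * u / 2 < s\<^sup>2"
      using u s by (simp add: power2_eq_square)
    then have "max 0 (sqrt (s * u / 2)) < s"
      using s real_sqrt_less_iff[of "s * u / 2" "s\<^sup>2"] by simp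
    then obtain q where q: "q \<in> \<rat>" "max 0 (sqrt (s * u / 2)) < q" "q < s"
      using Rats_dense_in_real by blast
    then have q0: "0 < q" by simp
    have "s * u / 2 < q\<^sup>2"
      using q q0 real_sqrt_less_iff[of "s * u / 2" "q\<^sup>2"] by simp
    then have "u / (q / s) < 2 * q"
      using s q0 by (simp add: field_simps power2_eq_square)
    then have ev1: "\<forall>\<^sub>F k in sequentially. u / (q / s) < R2 x \<gamma> q (a k)"
      using lim[OF q(1) q0] by (auto intro: order_tendstoD)
    have ev2: "\<forall>\<^sub>F k in sequentially. real (a (Suc k)) / real (a k) < s / q"
      using ratio q q0 by (auto intro: order_tendstoD)
    have "\<forall>\<^sub>F k in sequentially. u / (q / s) < R2 x \<gamma> q (a k) \<and>
        real (a (Suc k)) / real (a k) < s / q \<and> 0 < a k"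
      using ev1 ev2 pos by eventually_elim auto
    from eventually_between_subseq[OF a this]
    show "\<forall>\<^sub>F N in sequentially. u < R2 x \<gamma> s N"
    proof eventually_elim
      case (elim N)
      then obtain k where k: "u / (q / s) < R2 x \<gamma> q (a k)"
        "real (a (Suc k)) / real (a k) < s / q" "0 < a k" "a k \<le> N" "N < a (Suc k)"
        by blast
      have "q * N < q * a (Suc k)"
        using k q0 by simp
      also have "\<dots> < s * a k"
        using k q0 by (simp add: field_simps)
      finally have c: "q * N < s * a k" .
      have "N * u = (q / s * N) * (u / (q / s))"
        using q0 s by simp
      also have "\<dots> < (q / s * N) * R2 x \<gamma> q (a k)"
        using k q0 s by (intro mult_strict_left_mono) auto
      also have "\<dots> \<le> a k * R2 x \<gamma> q (a k)"
        using c s by (intro mult_right_mono R2_nonneg) (simp add: field_simps)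
      also have "\<dots> \<le> N * R2 x \<gamma> s N"
        using k c by (intro R2_le) (auto simp: field_simps)
      finally show ?case
        using k by simp
    qed
  }
qed

section \<open>Almost sure pair correlations of the random sequence\<close>

lemma R2_eq_sum_indicator:
  "R2 \<omega> \<beta> s N =
    (\<Sum>p\<in>{p \<in> {1..N} \<times> {1..N}. fst p \<noteq> snd p}. indicator (close_pair \<beta> (s / N) p) \<omega>) / N"
proof -
  let ?P = "{p \<in> {1..N} \<times> {1..N}. fst p \<noteq> snd p}"
  have "close_pairs \<omega> \<beta> (s / N) N = {p \<in> ?P. \<omega> \<in> close_pair \<beta> (s / N) p}"
    by (auto simp: close_pairs_def close_pair_def)
  moreover have "(\<Sum>p\<in>?P. indicator (close_pair \<beta> (s / N) p) \<omega>) =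
      real (card {p \<in> ?P. \<omega> \<in> close_pair \<beta> (s / N) p})"
    by (simp add: indicator_def sum.If_cases Int_def)
  ultimately show ?thesis by (simp add: R2_eq)
qed

lemma card_off_diagonal:
  "card {p \<in> {1..N} \<times> {1..N}. fst p \<noteq> snd p} = N * N - N"
proof -
  have "{p \<in> {1..N} \<times> {1..N}. fst p \<noteq> snd p} = {1..N} \<times> {1..N} - (\<lambda>n. (n, n)) ` {1..N}"
    by auto
  also have "card \<dots> = N * N - N"
    by (subst card_Diff_subset) (auto simp: card_image inj_on_def card_cartesian_product)
  finally show ?thesis .
qed

lemma measurable_R2 [measurable]: "(\<lambda>\<omega>. R2 \<omega> \<beta> s N) \<in> borel_measurable unif_seq"
  unfolding R2_eq_sum_indicator by measurable

lemma R2_le_N: "R2 x \<gamma> s N \<le> N"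
proof -
  have "card (close_pairs x \<gamma> (s / N) N) \<le> card ({1..N} \<times> {1..N})"
    by (rule card_mono) (auto simp: close_pairs_def)
  then have "real (card (close_pairs x \<gamma> (s / N) N)) \<le> real N * real N"
    by (simp add: card_cartesian_product flip: of_nat_mult)
  then show ?thesis by (simp add: R2_eq divide_le_eq)
qed

lemma integrable_R2_square: "integrable unif_seq (\<lambda>\<omega>. (R2 \<omega> \<beta> s N - c)\<^sup>2)"
proof (rule unif_seq.integrable_const_bound[where B="(N + \<bar>c\<bar>)\<^sup>2"])
  show "AE \<omega> in unif_seq. norm ((R2 \<omega> \<beta> s N - c)\<^sup>2) \<le> (N + \<bar>c\<bar>)\<^sup>2"
  proof (rule AE_I2)
    fix \<omega>
    have "\<bar>R2 \<omega> \<beta> s N - c\<bar> \<le> N + \<bar>c\<bar>"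
      using R2_le_N[of \<omega> \<beta> s N] R2_nonneg[of \<omega> \<beta> s N] by linarith
    then show "norm ((R2 \<omega> \<beta> s N - c)\<^sup>2) \<le> (N + \<bar>c\<bar>)\<^sup>2"
      using power_mono[of "\<bar>R2 \<omega> \<beta> s N - c\<bar>" "N + \<bar>c\<bar>" 2] by simp
  qed
qed measurable

text \<open>The centring term is the exact mean: \<open>N * N - N\<close> ordered pairs, each close
  with probability \<open>2 * s / N\<close>, divided by \<open>N\<close>. The condition
  \<open>2 * s < N\<close> makes the radius less than 1/2.\<close>

lemma variance_R2:
  assumes "0 < s" "2 * s < N"
  shows "(\<integral>\<omega>. (R2 \<omega> \<beta> s N - 2 * s * (1 - 1 / N))\<^sup>2 \<partial>unif_seq) \<le> 4 * s / N"
proof -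
  define P where "P = {p \<in> {1..N} \<times> {1..N}. fst p \<noteq> snd p}"
  have N: "0 < N" using assms by (auto intro: gr0I)
  have card: "real (card P) = real N * real N - real N"
    unfolding P_def card_off_diagonal using N by (subst of_nat_diff) auto
  have "R2 \<omega> \<beta> s N - 2 * s * (1 - 1 / N) =
      (\<Sum>p\<in>P. indicator (close_pair \<beta> (s / N) p) \<omega> - 2 * (s / N)) / N" for \<omega>
  proof -
    have *: "(\<Sum>p\<in>P. indicator (close_pair \<beta> (s / N) p) \<omega> - 2 * (s / N)) =
        (\<Sum>p\<in>P. indicator (close_pair \<beta> (s / N) p) \<omega>) - (real N * real N - real N) * (2 * (s / N))"
      by (simp add: sum_subtractf card)
    show ?thesis
      unfolding R2_eq_sum_indicator P_def[symmetric] * using N by (simp add: field_simps)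
  qed
  then have "(\<integral>\<omega>. (R2 \<omega> \<beta> s N - 2 * s * (1 - 1 / N))\<^sup>2 \<partial>unif_seq) =
      (\<integral>\<omega>. (\<Sum>p\<in>P. indicator (close_pair \<beta> (s / N) p) \<omega> - 2 * (s / N))\<^sup>2 \<partial>unif_seq) / N\<^sup>2"
    by (simp add: power_divide)
  also have "\<dots> \<le> 4 * (s / N) * card P / N\<^sup>2"
    using assms N by (intro divide_right_mono variance_close_pairs) (auto simp: field_simps P_def)
  also have "\<dots> \<le> 4 * (s / N) * N\<^sup>2 / N\<^sup>2"
    using assms by (intro divide_right_mono mult_left_mono) (auto simp: card power2_eq_square)
  finally show ?thesis
    using N by simp
qed

text \<open>Along the squares the variance bound \<open>4 * s / N\<close> becomes summable.\<close>

lemma AE_R2_squares: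
  assumes s: "0 < s"
  shows "AE \<omega> in unif_seq. (\<lambda>k. R2 \<omega> \<beta> s (k\<^sup>2)) \<longlonglongrightarrow> 2 * s"
proof -
  obtain K :: nat where K: "2 * s < K"
    using reals_Archimedean2 by blast
  with s have K0: "0 < K" by (auto intro: gr0I)
  \<comment> \<open>The offset \<open>K\<close> makes the variance bound applicable for every
    \<open>k\<close>; it is removed again at the end.\<close>
  let ?N = "\<lambda>k. (k + K)\<^sup>2"
  have "K \<le> ?N k" for k
    using K0 self_le_power[of "k + K" 2] by linarith
  then have N: "2 * s < ?N k" for k
    using K by (meson less_le_trans of_nat_le_iff)
  have "AE \<omega> in unif_seq. (\<lambda>k. (R2 \<omega> \<beta> s (?N k) - 2 * s * (1 - 1 / real (?N k)))\<^sup>2) \<longlonglongrightarrow> 0"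
  proof (rule AE_tendsto_0)
    show "(\<integral>\<omega>. (R2 \<omega> \<beta> s (?N k) - 2 * s * (1 - 1 / real (?N k)))\<^sup>2 \<partial>unif_seq) \<le> 4 * s / ?N k" for k
      using variance_R2[OF s N] by simp
    have "summable (\<lambda>k. inverse (real k ^ 2))"
      by (rule inverse_power_summable) simp
    from summable_mult[OF summable_ignore_initial_segment[OF this, of K], of "4 * s"]
    show "summable (\<lambda>k. 4 * s / ?N k)"
      by (simp add: divide_inverse)
  qed (auto intro: integrable_R2_square)
  then show ?thesis
  proof eventually_elim
    case (elim \<omega>)
    from tendsto_real_sqrt[OF this]
    have "(\<lambda>k. \<bar>R2 \<omega> \<beta> s (?N k) - 2 * s * (1 - 1 / real (?N k))\<bar>) \<longlonglongrightarrow> 0"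
      by simp
    then have 1: "(\<lambda>k. R2 \<omega> \<beta> s (?N k) - 2 * s * (1 - 1 / real (?N k))) \<longlonglongrightarrow> 0"
      by (rule tendsto_rabs_zero_cancel)
    have "(\<lambda>k. 1 / real (k\<^sup>2)) \<longlonglongrightarrow> 0"
      using lim_inverse_n'[THEN tendsto_power, of 2] by (simp add: power_divide)
    then have "(\<lambda>k. 1 / real (?N k)) \<longlonglongrightarrow> 0"
      by (rule LIMSEQ_ignore_initial_segment)
    then have 2: "(\<lambda>k. 2 * s * (1 - 1 / real (?N k))) \<longlonglongrightarrow> 2 * s * (1 - 0)"
      by (intro tendsto_intros)
    from tendsto_add[OF 1 2] have "(\<lambda>k. R2 \<omega> \<beta> s (?N k)) \<longlonglongrightarrow> 2 * s"
      by simp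
    then show ?case by (rule LIMSEQ_offset)
  qed
qed

text \<open>The exceptional null sets are indexed by \<open>\<beta>\<close> in \<open>B\<close> and
  positive rational \<open>q\<close>, so their union is null. Consecutive squares have ratio tending
  to 1, which extends convergence to all \<open>N\<close> and \<open>s\<close>.\<close>

lemma exists_PPC_countable:
  assumes "countable B"
  shows "\<exists>y. \<forall>\<beta>\<in>B. PPC \<beta> y"
proof -
  have Q: "countable (\<rat> \<inter> {0<..} :: real set)"
    by (simp add: countable_rat)
  have "AE \<omega> in unif_seq. \<forall>\<beta>\<in>B. \<forall>q\<in>\<rat> \<inter> {0<..}. (\<lambda>k. R2 \<omega> \<beta> q (k\<^sup>2)) \<longlonglongrightarrow> 2 * q"
    unfolding AE_ball_countable[OF assms] AE_ball_countable[OF Q] using AE_R2_squares by simp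
  then obtain y where y: "\<And>\<beta> q. \<beta> \<in> B \<Longrightarrow> q \<in> \<rat> \<Longrightarrow> 0 < q \<Longrightarrow> (\<lambda>k. R2 y \<beta> q (k\<^sup>2)) \<longlonglongrightarrow> 2 * q"
    using eventually_happens'[OF unif_seq.ae_filter_bot] by blast
  have "PPC \<beta> y" if "\<beta> \<in> B" for \<beta>
  proof (rule PPC_subseqI)
    show "strict_mono (\<lambda>k::nat. k\<^sup>2)"
      by (auto simp: strict_mono_def power_strict_mono)
    have "(\<lambda>k. real (Suc k) / real k) \<longlonglongrightarrow> 1"
      by (rule LIMSEQ_Suc_n_over_n)
    from tendsto_power[OF this, of 2]
    show "(\<lambda>k. real ((Suc k)\<^sup>2) / real (k\<^sup>2)) \<longlonglongrightarrow> 1"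
      by (simp add: power_divide)
  qed (use y that in auto)
  then show ?thesis by blast
qed

section \<open>Interleaving a sequence with its shift\<close>

definition interleave :: "real \<Rightarrow> (nat \<Rightarrow> real) \<Rightarrow> nat \<Rightarrow> real" where
  "interleave c y n = frac (y (Suc n div 2) + (if even n then c else 0))"

lemma interleave_double: "interleave c y (2 * j) = frac (y j + c)"
  by (simp add: interleave_def)

lemma interleave_double_pred: "0 < j \<Longrightarrow> interleave c y (2 * j - Suc 0) = frac (y j)"
  by (cases j) (simp_all add: interleave_def)

lemma int_dist_frac_diff: "int_dist (frac a - frac b - \<gamma>) = int_dist (a - b - \<gamma>)"
  using int_dist_add_int[of "a - b - \<gamma>" "\<lfloor>b\<rfloor> - \<lfloor>a\<rfloor>"] by (simp add: frac_def algebra_simps)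

lemma R2_eq_sum:
  "R2 x \<gamma> s N =
    (\<Sum>m\<in>{1..N}. \<Sum>n\<in>{1..N}. of_bool (m \<noteq> n \<and> int_dist (x m - x n - \<gamma>) \<le> s / N)) / N"
proof -
  have "close_pairs x \<gamma> (s / N) N =
      (SIGMA m:{1..N}. {n \<in> {1..N}. m \<noteq> n \<and> int_dist (x m - x n - \<gamma>) \<le> s / N})"
    by (auto simp: close_pairs_def)
  then show ?thesis
    by (simp add: R2_eq card_SigmaI of_bool_def sum.If_cases Int_def)
qed

lemma sum_double_split:
  fixes f :: "nat \<Rightarrow> 'a::comm_monoid_add"
  shows "(\<Sum>n\<in>{1..2 * M}. f n) = (\<Sum>j\<in>{1..M}. f (2 * j - 1) + f (2 * j))"
  by (induction M) (simp_all add: add.assoc)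

text \<open>Indices are grouped into blocks {2j-1, 2j}. Two distinct blocks have differences y j - y
  k (twice) and y j - y k plus or minus \<open>c\<close>; within a block the differences are plus or
  minus \<open>c\<close>, which \<open>far\<close> excludes. The radius \<open>s / (2 * M)\<close>
  equals \<open>(s / 2) / M\<close>, hence the parameter \<open>s / 2\<close>.\<close>

lemma R2_interleave:
  assumes M: "0 < M" and far: "s / real (2 * M) < int_dist (c - \<gamma>)" "s / real (2 * M) < int_dist (c + \<gamma>)"
  shows "R2 (interleave c y) \<gamma> s (2 * M) =
    R2 y \<gamma> (s / 2) M + (R2 y (\<gamma> - c) (s / 2) M + R2 y (\<gamma> + c) (s / 2) M) / 2"
proof -
  let ?x = "interleave c y" and ?r = "s / real (2 * M)"
  define g where "g m n = (of_bool (m \<noteq> n \<and> int_dist (?x m - ?x n - \<gamma>) \<le> ?r) :: real)" for m n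
  define h where "h \<beta> j k = (of_bool (j \<noteq> k \<and> int_dist (y j - y k - \<beta>) \<le> ?r) :: real)" for \<beta> j k
  have far': "\<not> int_dist (- c - \<gamma>) \<le> ?r"
    using far(2) int_dist_minus[of "c + \<gamma>"] by (simp add: minus_diff_commute add.commute)
  have eq: "g (2*j-1) (2*k-1) + g (2*j-1) (2*k) + (g (2*j) (2*k-1) + g (2*j) (2*k)) =
      2 * h \<gamma> j k + h (\<gamma> - c) j k + h (\<gamma> + c) j k" if "0 < j" "0 < k" for j k
  proof (cases "j = k")
    case True
    moreover have "2 * k \<noteq> 2 * k - 1" using that by linarith
    ultimately show ?thesis
      using that far(1) far'
      by (simp add: g_def h_def interleave_double interleave_double_pred int_dist_frac_diff)
  next
    case False
    then have ne: "2*j-1 \<noteq> 2*k-1" "2*j-1 \<noteq> 2*k" "2*j \<noteq> 2*k-1" "2*j \<noteq> 2*k"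
      using that by presburger+
    have "int_dist (?x (2*j-1) - ?x (2*k-1) - \<gamma>) = int_dist (y j - y k - \<gamma>)"
      "int_dist (?x (2*j-1) - ?x (2*k) - \<gamma>) = int_dist (y j - y k - (\<gamma> + c))"
      "int_dist (?x (2*j) - ?x (2*k-1) - \<gamma>) = int_dist (y j - y k - (\<gamma> - c))"
      "int_dist (?x (2*j) - ?x (2*k) - \<gamma>) = int_dist (y j - y k - \<gamma>)"
      unfolding One_nat_def interleave_double interleave_double_pred[OF that(1)]
        interleave_double_pred[OF that(2)] int_dist_frac_diff
      by (simp_all add: algebra_simps)
    with ne False show ?thesis
      unfolding g_def h_def by (simp only: simp_thms)
  qed
  have H: "(\<Sum>j\<in>{1..M}. \<Sum>k\<in>{1..M}. h \<beta> j k) = M * R2 y \<beta> (s / 2) M" for \<beta>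
    using M by (simp add: R2_eq_sum h_def)
  have "R2 ?x \<gamma> s (2 * M) = (\<Sum>m\<in>{1..2*M}. \<Sum>n\<in>{1..2*M}. g m n) / (2 * M)"
    unfolding R2_eq_sum g_def by simp
  also have "(\<Sum>m\<in>{1..2*M}. \<Sum>n\<in>{1..2*M}. g m n) =
      (\<Sum>j\<in>{1..M}. \<Sum>k\<in>{1..M}. g (2*j-1) (2*k-1) + g (2*j-1) (2*k) + (g (2*j) (2*k-1) + g (2*j) (2*k)))"
    by (simp only: sum_double_split sum.distrib)
  also have "\<dots> = (\<Sum>j\<in>{1..M}. \<Sum>k\<in>{1..M}. 2 * h \<gamma> j k + h (\<gamma> - c) j k + h (\<gamma> + c) j k)"
    by (intro sum.cong refl eq) auto
  also have "\<dots> = 2 * (\<Sum>j\<in>{1..M}. \<Sum>k\<in>{1..M}. h \<gamma> j k) +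
      (\<Sum>j\<in>{1..M}. \<Sum>k\<in>{1..M}. h (\<gamma> - c) j k) + (\<Sum>j\<in>{1..M}. \<Sum>k\<in>{1..M}. h (\<gamma> + c) j k)"
    by (simp add: sum.distrib sum_distrib_left)
  finally show ?thesis
    using M unfolding H by (simp add: add_divide_distrib)
qed

lemma PPC_interleave:
  assumes y: "PPC \<gamma> y" "PPC (\<gamma> - c) y" "PPC (\<gamma> + c) y"
    and far: "0 < int_dist (c - \<gamma>)" "0 < int_dist (c + \<gamma>)"
  shows "PPC \<gamma> (interleave c y)"
proof (rule PPC_subseqI)
  show "strict_mono (\<lambda>k::nat. 2 * k)"
    by (simp add: strict_mono_def)
  show "(\<lambda>k. real (2 * Suc k) / real (2 * k)) \<longlonglongrightarrow> 1"
  proof -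
    have "(\<lambda>k. real (2 * Suc k) / real (2 * k)) = (\<lambda>k. real (Suc k) / real k)"
      by (simp only: of_nat_mult mult_divide_mult_cancel_left)
    then show ?thesis
      using LIMSEQ_Suc_n_over_n[where ?'a=real] by simp
  qed
  fix q :: real assume q: "0 < q"
  \<comment> \<open>The three limits are each \<open>q\<close>, so the total is q + (q + q) / 2 =
    2q. Even lengths suffice by \<open>PPC_subseqI\<close>.\<close>
  have lim: "(\<lambda>M. R2 y \<gamma> (q / 2) M + (R2 y (\<gamma> - c) (q / 2) M + R2 y (\<gamma> + c) (q / 2) M) / 2)
      \<longlonglongrightarrow> 2 * (q / 2) + (2 * (q / 2) + 2 * (q / 2)) / 2"
    using y q by (intro tendsto_intros) (simp_all only: PPC_def half_gt_zero_iff)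
  have "(\<lambda>M. q / 2 * (1 / real M)) \<longlonglongrightarrow> q / 2 * 0"
    by (intro tendsto_intros lim_1_over_n)
  then have "(\<lambda>M. q / real (2 * M)) \<longlonglongrightarrow> 0"
    by simp
  then have "\<forall>\<^sub>F M in sequentially. q / real (2 * M) < int_dist (c - \<gamma>)"
    "\<forall>\<^sub>F M in sequentially. q / real (2 * M) < int_dist (c + \<gamma>)"
    using far by (auto intro: order_tendstoD)
  with eventually_gt_at_top[of 0]
  have "\<forall>\<^sub>F M in sequentially. R2 y \<gamma> (q / 2) M + (R2 y (\<gamma> - c) (q / 2) M + R2 y (\<gamma> + c) (q / 2) M) / 2 =
      R2 (interleave c y) \<gamma> q (2 * M)"
    by eventually_elim (rule R2_interleave[symmetric])
  from Lim_transform_eventually[OF lim this]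
  show "(\<lambda>M. R2 (interleave c y) \<gamma> q (2 * M)) \<longlonglongrightarrow> 2 * q"
    by simp
qed

text \<open>The \<open>M\<close> pairs (2j, 2j-1) have difference exactly \<open>c\<close> modulo 1
  and are counted at every nonnegative radius.\<close>

lemma R2_interleave_ge:
  assumes "0 < M" "0 \<le> s"
  shows "1 / 2 \<le> R2 (interleave c y) c s (2 * M)"
proof -
  let ?C = "close_pairs (interleave c y) c (s / real (2 * M)) (2 * M)"
  have "(\<lambda>j. (2 * j, 2 * j - 1)) ` {1..M} \<subseteq> ?C"
  proof
    fix p assume "p \<in> (\<lambda>j. (2 * j, 2 * j - 1)) ` {1..M}"
    then obtain j where j: "p = (2 * j, 2 * j - 1)" "0 < j" "j \<le> M" by auto
    have "int_dist (interleave c y (2 * j) - interleave c y (2 * j - 1) - c) \<le> 0"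
      unfolding One_nat_def interleave_double interleave_double_pred[OF j(2)] int_dist_frac_diff
      using int_dist_le[of 0 0] by simp
    also have "0 \<le> s / real (2 * M)"
      using assms by simp
    finally show "p \<in> ?C"
      using j by (auto simp: close_pairs_def)
  qed
  then have "card ((\<lambda>j. (2 * j, 2 * j - 1)) ` {1..M}) \<le> card ?C"
    by (intro card_mono) auto
  then have "M \<le> card ?C"
    by (simp add: card_image inj_on_def)
  then show ?thesis
    using assms by (simp add: R2_eq field_simps)
qed

lemma not_PPC_interleave: "\<not> PPC c (interleave c y)"
proof
  assume "PPC c (interleave c y)"
  \<comment> \<open>Any positive \<open>s\<close> below 1/4 would do, since then the required limit
    \<open>2 * s\<close> is below 1/2.\<close>
  then have "(\<lambda>N. R2 (interleave c y) c (1/8) N) \<longlonglongrightarrow> 1/4"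
    unfolding PPC_def by (auto dest!: spec[of _ "1/8"])
  then have "(\<lambda>M. R2 (interleave c y) c (1/8) (2 * M)) \<longlonglongrightarrow> 1/4"
    by (rule filterlim_compose) (auto intro!: filterlim_subseq simp: strict_mono_def)
  then have "1/2 \<le> (1/4 :: real)"
    by (rule tendsto_lowerbound)
      (use R2_interleave_ge in \<open>auto intro!: eventually_mono[OF eventually_gt_at_top[of 0]]\<close>)
  then show False by simp
qed

lemma int_dist_pos_of_abs_less_1:
  assumes "x \<noteq> 0" "\<bar>x\<bar> < 1"
  shows "0 < int_dist x"
proof (rule int_dist_pos)
  show "x \<notin> \<int>"
    using assms by (auto elim!: Ints_cases)
qed

theorem theorem4:
  fixes \<gamma>1 \<gamma>2 :: real
  assumes "\<gamma>1 \<in> {0..1/2}" and "\<gamma>2 \<in> {0..1/2}" and "\<gamma>1 \<noteq> \<gamma>2"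
  shows "\<exists>x :: nat \<Rightarrow> real. (\<forall>n. x n \<in> {0..1}) \<and> PPC \<gamma>1 x \<and> \<not> PPC \<gamma>2 x"
proof -
  obtain y where y: "\<forall>\<beta>\<in>{\<gamma>1, \<gamma>1 - \<gamma>2, \<gamma>1 + \<gamma>2}. PPC \<beta> y"
    using exists_PPC_countable[of "{\<gamma>1, \<gamma>1 - \<gamma>2, \<gamma>1 + \<gamma>2}"] by auto
  \<comment> \<open>As \<open>\<gamma>1\<close> and \<open>\<gamma>2\<close> are distinct points of
    [0,1/2], their difference is nonzero and at most 1/2 in absolute value, and their sum lies
    strictly between 0 and 1. So neither is an integer.\<close>
  have "PPC \<gamma>1 (interleave \<gamma>2 y)"
    using y assms by (intro PPC_interleave int_dist_pos_of_abs_less_1) auto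
  moreover have "interleave \<gamma>2 y n \<in> {0..1}" for n
    by (simp add: interleave_def less_imp_le frac_lt_1)
  ultimately show ?thesis
    using not_PPC_interleave by blast
qed

end
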